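(* Let $\mathbb{K}$ be a commutative field and let $\mathcal{A}=\{H_{p_1},\dots,H_{p_6}\}$ be a generic arrangement of $6$ lines in $\mathbb{K}^2$, with normal vectors $\alpha_{p_1},\dots,\alpha_{p_6}$. Let $\mathbb{T}=\{L_1,L_2,L_3,L_4\}$ with $L_1=\{p_1,p_2,p_3\}$, $L_2=\{p_1,p_5,p_6\}$, $L_3=\{p_2,p_4,p_6\}$, $L_4=\{p_3,p_4,p_5\}$. Then the following statements are equivalent: (i) the arrangement $\mathcal{A}$ admits a $K_{\mathbb{T}}$-translated; (ii) the equation $$\frac{|\alpha_{p_1}\alpha_{p_5}|\,|\alpha_{p_2}\alpha_{p_6}|\,|\alpha_{p_3}\alpha_{p_4}|}{|\alpha_{p_1}\alpha_{p_6}|\,|\alpha_{p_2}\alpha_{p_4}|\,|\alpha_{p_3}\alpha_{p_5}|}=1$$ is satisfied; (iii) there is an involution $f$ on the line at infinity which satisfies $f(H_{p_j})=H_{p_{j+3}}$ for all $j\in\mathbb{Z}_6$ (indices $j$ taken modulo $6$).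
   Context: A generic arrangement of $n$ lines in $\mathbb{K}^2$ is a central arrangement $\{H_1,\dots,H_n\}$ of $n$ pairwise distinct lines through the origin; $\alpha_p\in(\mathbb{K}^2)^*$ is a nonzero vector normal to $H_p$, i.e. $H_p=\ker\alpha_p$. Its translates are the arrangements $\{H_1^{x_1},\dots,H_n^{x_n}\}$, $(x_1,\dots,x_n)\in\mathbb{K}^n$, where $H_i^{x_i}$ is a line parallel to $H_i$ (up to rescaling of the coordinate $x_i$, $H_i^{x_i}=\{v:\alpha_i(v)=x_i\}$). Here $p_1,\dots,p_6$ are the six distinct indices of the lines. A $K_{\mathbb{T}}$-translated of $\mathcal{A}$ is a translate of $\mathcal{A}$ such that for each $i=1,\dots,4$ the intersection $P_i$ of the three translated lines indexed by $L_i$ is a point, and $P_i$ belongs to exactly the three translated lines indexed by $L_i$ and to no other line of the translate. $|v\,w|$ denotes the determinant of the $2\times2$ matrix with columns $v,w$. The line at infinity is the projective line $\mathbb{P}(\mathbb{K}^2)$; each line $H_p$ determines a point of it (its direction), also denoted $H_p$. An involution is a projective transformation $f\in PGL(2,\mathbb{K})$ with $f^2=\mathrm{id}$. *)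

theory Defs
  imports "HOL-Analysis.Determinants"
begin

(* The projective line P(K^2), whose points are the lines through the origin of the plane K^2.
   It serves as the line at infinity: the direction of a line through the origin is that line
   itself, regarded as a point of this set. *)
definition line_at_infinity :: "('a::field ^ 2) set set" where
  "line_at_infinity = {L. vec.subspace L \<and> vec.dim L = 1}"

(* The lines carry labels from an index set I. *)
definition generic_arrangement :: "'i set \<Rightarrow> ('i \<Rightarrow> ('a::field ^ 2) set) \<Rightarrow> bool" where
  "generic_arrangement I H \<longleftrightarrow> finite I \<and> (\<forall>i\<in>I. H i \<in> line_at_infinity) \<and> inj_on H I"

(* A nonzero linear form on K^2, given by its coordinate vector, whose kernel is L. *)
definition normal_vector :: "'a::field ^ 2 \<Rightarrow> ('a ^ 2) set \<Rightarrow> bool" where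
  "normal_vector a L \<longleftrightarrow> a \<noteq> 0 \<and> L = {v. scalar_product a v = 0}"

definition parallel :: "('a::field ^ 2) set \<Rightarrow> ('a ^ 2) set \<Rightarrow> bool" where
  "parallel L M \<longleftrightarrow> (\<exists>u. M = (\<lambda>v. u + v) ` L)"

definition is_translate ::
  "'i set \<Rightarrow> ('i \<Rightarrow> ('a::field ^ 2) set) \<Rightarrow> ('i \<Rightarrow> ('a ^ 2) set) \<Rightarrow> bool" where
  "is_translate I H M \<longleftrightarrow> (\<forall>i\<in>I. parallel (H i) (M i))"

definition is_KT_translated ::
  "'i set \<Rightarrow> ('i \<Rightarrow> ('a::field ^ 2) set) \<Rightarrow> 'i set set \<Rightarrow> ('i \<Rightarrow> ('a ^ 2) set) \<Rightarrow> bool" where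
  "is_KT_translated I H T M \<longleftrightarrow>
     is_translate I H M \<and>
     (\<forall>L\<in>T. \<exists>P. (\<Inter>i\<in>L. M i) = {P} \<and> {i \<in> I. P \<in> M i} = L)"

definition admits_KT_translated ::
  "'i set \<Rightarrow> ('i \<Rightarrow> ('a::field ^ 2) set) \<Rightarrow> 'i set set \<Rightarrow> bool" where
  "admits_KT_translated I H T \<longleftrightarrow> (\<exists>M. is_KT_translated I H T M)"

definition det2 :: "'a::field ^ 2 \<Rightarrow> 'a ^ 2 \<Rightarrow> 'a" where
  "det2 v w = det (transpose (vector [v, w]) :: 'a ^ 2 ^ 2)"

(* The elements of PGL(2,K), as maps on the points of the projective line; values of f outside
   line_at_infinity are irrelevant. *)
definition projective_transformation :: "(('a::field ^ 2) set \<Rightarrow> ('a ^ 2) set) \<Rightarrow> bool" where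
  "projective_transformation f \<longleftrightarrow>
     (\<exists>A :: 'a ^ 2 ^ 2. invertible A \<and> (\<forall>L\<in>line_at_infinity. f L = (*v) A ` L))"

definition projective_involution :: "(('a::field ^ 2) set \<Rightarrow> ('a ^ 2) set) \<Rightarrow> bool" where
  "projective_involution f \<longleftrightarrow>
     projective_transformation f \<and> (\<forall>L\<in>line_at_infinity. f (f L) = L)"

(* Translates in coordinates: the lines parallel to the kernel of a nonzero form are exactly
   the level sets of that form. *)
lemma parallel_iff_level_set:
  fixes a :: "'a::field ^ 2"
  assumes "normal_vector a L"
  shows "parallel L M \<longleftrightarrow> (\<exists>x. M = {v. scalar_product a v = x})"
proof -
  have add: "scalar_product a (u + v) = scalar_product a u + scalar_product a v" for u v
    by (simp add: scalar_product_def sum_2 algebra_simps)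
  have img: "(\<lambda>v. u + v) ` L = {v. scalar_product a v = scalar_product a u}" (is "?l = ?r") for u
  proof
    show "?l \<subseteq> ?r"
      using assms by (auto simp: normal_vector_def add)
    show "?r \<subseteq> ?l"
    proof
      fix v assume "v \<in> ?r"
      then have "scalar_product a (v - u) = 0"
        using add[of u "v - u"] by simp
      then have "v - u \<in> L" using assms by (simp add: normal_vector_def)
      then show "v \<in> ?l" by (intro image_eqI[of _ _ "v - u"]) simp_all
    qed
  qed
  have "\<exists>u. scalar_product a u = x" for x
  proof -
    obtain i where i: "a $ i \<noteq> 0"
      using assms by (auto simp: normal_vector_def vec_eq_iff)
    have "scalar_product a (axis i (x / a $ i)) = x"
      using i by (simp add: scalar_product_def axis_def if_distrib cong: if_cong)
    then show ?thesis ..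
  qed
  then show ?thesis
    unfolding parallel_def img by metis
qed

end

(* For (i) and (ii), put P1 at the origin, so that P2, P3, P4 are multiples a, b, c of the
   directions d1, d2, d3. The lines P2P3, P3P4, P2P4 are parallel to H6, H4, H5 exactly when
   a|61| = b|62|, b|42| = c|43| and a|51| = c|53|, and this homogeneous system has a nonzero
   solution exactly when (ii) holds.
   For (ii) and (iii), a matrix A exchanging the lines of d1 and d4 is antidiagonal in the basis
   d1, d4, hence A^2 is scalar. That A maps d2 to a multiple of d5 fixes the ratio of the two
   entries of A, and that A maps d3 to a multiple of d6 becomes (ii) by Pluecker relations. *)
theory Submission
  imports Defs
begin

section \<open>Determinants, linear forms and their kernels in coordinates\<close>

lemma det2_eq: "det2 v w = v $ 1 * w $ 2 - v $ 2 * w $ 1"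
  by (simp add: det2_def det_2 transpose_def)

lemma scalar_product_2: "scalar_product (a :: 'a::field ^ 2) v = a $ 1 * v $ 1 + a $ 2 * v $ 2"
  by (simp add: scalar_product_def sum_2)

lemma vec_eq_2: "(v :: 'a ^ 2) = w \<longleftrightarrow> v $ 1 = w $ 1 \<and> v $ 2 = w $ 2"
  by (simp add: vec_eq_iff forall_2)

lemma det2_swap: "det2 w v = - det2 v w"
  by (simp add: det2_eq)

lemma det2_eq_0_imp_multiple:
  assumes "det2 v w = 0" and "w \<noteq> 0"
  obtains c where "v = c *s w"
proof (cases "w $ 1 = 0")
  case True
  then show thesis
    using assms that[of "v $ 2 / w $ 2"] by (auto simp: det2_eq vec_eq_2)
next
  case False
  then show thesis
    using assms that[of "v $ 1 / w $ 1"] by (auto simp: det2_eq vec_eq_2 field_simps)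
qed

text \<open>A quarter turn: it carries a normal vector to a spanning vector of its kernel and
  preserves determinants, so the equation in (ii) reads the same for normals and for
  directions.\<close>

definition direction :: "'a::field ^ 2 \<Rightarrow> 'a ^ 2" where
  "direction a = vector [a $ 2, - a $ 1]"

lemma direction_nth [simp]: "direction a $ 1 = a $ 2" "direction a $ 2 = - a $ 1"
  by (simp_all add: direction_def)

lemma direction_eq_0_iff [simp]: "direction a = 0 \<longleftrightarrow> a = 0"
  by (auto simp: vec_eq_2)

lemma det2_direction [simp]: "det2 (direction a) (direction b) = det2 a b"
  by (simp add: det2_eq)

lemma scalar_product_direction: "scalar_product a (direction b) = det2 a b"
  by (simp add: scalar_product_2 det2_eq)

lemma scalar_product_scale: "scalar_product a (c *s v) = c * scalar_product (a :: 'a::field ^ 2) v"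
  by (simp add: scalar_product_2 algebra_simps)

lemma scalar_product_0: "scalar_product (a :: 'a::field ^ 2) 0 = 0"
  by (simp add: scalar_product_2)

lemma scalar_product_diff:
  "scalar_product a (v - w) = scalar_product (a :: 'a::field ^ 2) v - scalar_product a w"
  by (simp add: scalar_product_2 algebra_simps)

lemma scalar_product_eq_0_imp_multiple:
  assumes "scalar_product a v = 0" and "a \<noteq> 0"
  obtains c where "v = c *s direction a"
proof -
  have "det2 v (direction a) = 0"
    using assms(1) unfolding det2_eq scalar_product_2 direction_nth by algebra
  then show thesis using assms(2) that by (metis det2_eq_0_imp_multiple direction_eq_0_iff)
qed

lemma normal_vector_imp_range:
  assumes "normal_vector a L"
  shows "L = range (\<lambda>c. c *s direction a)"
proof -
  have L: "L = {v. scalar_product a v = 0}" and "a \<noteq> 0"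
    using assms by (simp_all add: normal_vector_def)
  then have "v \<in> range (\<lambda>c. c *s direction a)" if "v \<in> L" for v
    using that by (auto elim: scalar_product_eq_0_imp_multiple)
  moreover have "c *s direction a \<in> L" for c
    by (simp add: L scalar_product_scale scalar_product_direction det2_eq)
  ultimately show ?thesis by blast
qed

text \<open>Proportional nonzero forms have the same kernel. Distinctness of the lines enters all
  later computations in this form.\<close>

lemma det2_normals_neq_0:
  assumes a: "normal_vector a L" and b: "normal_vector b M" and "L \<noteq> M"
  shows "det2 a b \<noteq> 0"
proof
  assume "det2 a b = 0"
  then obtain c where c: "a = c *s b"
    using b by (auto simp: normal_vector_def elim: det2_eq_0_imp_multiple)
  then have "scalar_product a v = c * scalar_product b v" for v
    by (simp add: scalar_product_2 algebra_simps)
  moreover have "c \<noteq> 0" using a c by (auto simp: normal_vector_def)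
  ultimately have "L = M"
    using a b by (simp add: normal_vector_def)
  with \<open>L \<noteq> M\<close> show False ..
qed

text \<open>Cramer's rule: two lines that are not parallel share at most one point.\<close>

lemma scalar_product_eq_imp_eq:
  assumes "det2 a b \<noteq> 0"
    and "scalar_product a v = scalar_product a w" and "scalar_product b v = scalar_product b w"
  shows "v = w"
proof -
  have "det2 a b * (v $ 1 - w $ 1) = 0" "det2 a b * (v $ 2 - w $ 2) = 0"
    using assms(2,3) unfolding det2_eq scalar_product_2 by algebra+
  then show ?thesis using assms(1) by (simp add: vec_eq_2)
qed

lemma det2_pluecker:
  "det2 a b * det2 c d - det2 a c * det2 b d + det2 a d * det2 b c = 0"
  unfolding det2_eq by algebra

section \<open>Concurrent triples and the determinant equation\<close>

text \<open>The vectors \<open>u\<close>, \<open>v\<close>, \<open>w\<close> stand for the vertices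
  P2, P3, P4 seen from P1. Eliminating their coefficients around the triangle P2 P4 P3 leaves the
  equation multiplied by the coefficient of \<open>u\<close>, which is nonzero.\<close>

lemma det2_condition_of_vertices:
  fixes u v w :: "'a::field ^ 2"
  assumes "a1 \<noteq> 0" "a2 \<noteq> 0" "a3 \<noteq> 0" and "u \<noteq> 0"
    and "scalar_product a1 u = 0" "scalar_product a2 v = 0" "scalar_product a3 w = 0"
    and "scalar_product a6 u = scalar_product a6 v"
    and "scalar_product a4 v = scalar_product a4 w"
    and "scalar_product a5 u = scalar_product a5 w"
  shows "det2 a1 a5 * det2 a2 a6 * det2 a3 a4 = det2 a1 a6 * det2 a2 a4 * det2 a3 a5"
proof -
  obtain a b c where u: "u = a *s direction a1" and v: "v = b *s direction a2"
    and w: "w = c *s direction a3"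
    using assms scalar_product_eq_0_imp_multiple by metis
  have "a \<noteq> 0" using u \<open>u \<noteq> 0\<close> by auto
  have "a * det2 a6 a1 = b * det2 a6 a2" "b * det2 a4 a2 = c * det2 a4 a3"
    "a * det2 a5 a1 = c * det2 a5 a3"
    using assms(8-10) by (simp_all add: u v w scalar_product_scale scalar_product_direction)
  then have "a * (det2 a1 a5 * det2 a2 a6 * det2 a3 a4) =
      a * (det2 a1 a6 * det2 a2 a4 * det2 a3 a5)"
    unfolding det2_swap[of a6] det2_swap[of a5] det2_swap[of a4 a2] det2_swap[of a4 a3] by algebra
  with \<open>a \<noteq> 0\<close> show ?thesis by simp
qed

section \<open>Matrices acting on the line at infinity\<close>

lemma image_range_scale:
  fixes A :: "'a::field ^ 2 ^ 2"
  assumes "A *v e = c *s e'" and "c \<noteq> 0"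
  shows "(*v) A ` range (\<lambda>k. k *s e) = range (\<lambda>k. k *s e')"
proof -
  have "(*v) A ` range (\<lambda>k. k *s e) = range (\<lambda>k. (k * c) *s e')"
    by (simp add: image_image vector_scalar_commute assms(1))
  also have "\<dots> = (\<lambda>k. k *s e') ` range (\<lambda>k. k * c)"
    by (simp add: image_image)
  also have "range (\<lambda>k. k * c) = UNIV"
    using \<open>c \<noteq> 0\<close> by (intro surjI[of _ "\<lambda>k. k / c"]) simp
  finally show ?thesis .
qed

lemma involutory_matrix_exists:
  fixes e1 e2 e3 e4 e5 e6 :: "'a::field ^ 2"
  assumes nz: "det2 e1 e4 \<noteq> 0" "det2 e2 e4 \<noteq> 0" "det2 e4 e5 \<noteq> 0" "det2 e1 e2 \<noteq> 0" "det2 e1 e5 \<noteq> 0"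
    and eq: "det2 e1 e5 * det2 e2 e6 * det2 e3 e4 = det2 e1 e6 * det2 e2 e4 * det2 e3 e5"
  obtains A :: "'a ^ 2 ^ 2" and k where "k \<noteq> 0" and "\<And>v. A *v (A *v v) = k *s v"
    and "det2 (A *v e1) e4 = 0" "det2 (A *v e2) e5 = 0" "det2 (A *v e3) e6 = 0"
proof -
  \<comment> \<open>These values make the two terms of \<open>det2 (A *v e2) e5\<close>, namely
    \<open>s * det2 e1 e2 * det2 e1 e5\<close> and \<open>t * det2 e2 e4 * det2 e4 e5\<close>,
    cancel.\<close>
  define s t where "s = det2 e2 e4 * det2 e5 e4" and "t = det2 e1 e2 * det2 e1 e5"
  \<comment> \<open>A sum of two rank-one matrices, one with image along \<open>e4\<close> and
    kernel along \<open>e4\<close>, the other likewise for \<open>e1\<close>. Hence \<open>A\<close>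
    exchanges the lines of \<open>e1\<close> and \<open>e4\<close>.\<close>
  define A :: "'a ^ 2 ^ 2" where
    "A = (\<chi> i j. t * e4 $ i * direction e4 $ j - s * e1 $ i * direction e1 $ j)"
  have A: "A *v v = (s * det2 e1 v) *s e1 + (t * det2 v e4) *s e4" for v
    by (simp add: A_def vec_eq_2 matrix_vector_mult_def sum_2 det2_eq algebra_simps)
  show thesis
  proof (rule that)
    show "s * t * (det2 e1 e4)\<^sup>2 \<noteq> 0"
      using nz by (auto simp: s_def t_def det2_swap[of e5 e4])
    show "A *v (A *v v) = (s * t * (det2 e1 e4)\<^sup>2) *s v" for v
      unfolding A vec_eq_2 det2_eq by (simp add: power2_eq_square algebra_simps)
    show "det2 (A *v e1) e4 = 0"
      unfolding A det2_eq by (simp add: algebra_simps)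
    show "det2 (A *v e2) e5 = 0"
      unfolding A s_def t_def det2_eq by (simp add: algebra_simps)
    have "det2 (A *v e3) e6 = det2 e1 e4 *
        (det2 e1 e5 * det2 e2 e6 * det2 e3 e4 - det2 e1 e6 * det2 e2 e4 * det2 e3 e5)"
      unfolding A s_def t_def det2_eq by (simp add: algebra_simps)
    then show "det2 (A *v e3) e6 = 0" using eq by simp
  qed
qed

text \<open>In the basis \<open>e1\<close>, \<open>e4\<close> the matrix is antidiagonal with
  entries \<open>s\<close> and \<open>t\<close>, and each of the two remaining pairs gives a linear
  relation between them.\<close>

lemma det2_condition_of_matrix:
  fixes A :: "'a::field ^ 2 ^ 2"
  assumes nz: "det2 e1 e4 \<noteq> 0" and A1: "A *v e1 = t *s e4" and A4: "A *v e4 = s *s e1"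
    and "t \<noteq> 0" and "det2 (A *v e2) e5 = 0" "det2 (A *v e3) e6 = 0"
  shows "det2 e1 e5 * det2 e2 e6 * det2 e3 e4 = det2 e1 e6 * det2 e2 e4 * det2 e3 e5"
proof -
  have A: "det2 e1 e4 *s (A *v v) = (det2 v e4 * t) *s e4 + (det2 e1 v * s) *s e1" for v
  proof -
    have "det2 e1 e4 *s v = det2 v e4 *s e1 + det2 e1 v *s e4"
      by (simp add: vec_eq_2 det2_eq algebra_simps)
    then have "A *v (det2 e1 e4 *s v) = A *v (det2 v e4 *s e1 + det2 e1 v *s e4)" by simp
    then show ?thesis
      by (simp add: matrix_vector_right_distrib vector_scalar_commute A1 A4)
  qed
  have eq: "det2 v e4 * t * det2 e4 w + det2 e1 v * s * det2 e1 w = 0" if "det2 (A *v v) w = 0" for v w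
  proof -
    have "det2 (det2 e1 e4 *s (A *v v)) w = 0"
      using that by (simp add: det2_eq mult.assoc flip: right_diff_distrib)
    then show ?thesis unfolding A by (simp add: det2_eq algebra_simps)
  qed
  \<comment> \<open>Elimination of \<open>s\<close> from the relations for the pairs
    \<open>e2\<close>, \<open>e5\<close> and \<open>e3\<close>, \<open>e6\<close>.\<close>
  have "t * (det2 e2 e4 * det2 e4 e5 * (det2 e1 e3 * det2 e1 e6)) =
      t * (det2 e3 e4 * det2 e4 e6 * (det2 e1 e2 * det2 e1 e5))"
    using eq[OF assms(5)] eq[OF assms(6)] by algebra
  then have "det2 e2 e4 * det2 e4 e5 * (det2 e1 e3 * det2 e1 e6) =
      det2 e3 e4 * det2 e4 e6 * (det2 e1 e2 * det2 e1 e5)"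
    using \<open>t \<noteq> 0\<close> by simp
  \<comment> \<open>The Pluecker relations rewrite \<open>det2 e1 e2 * det2 e4 e6\<close> and
    \<open>det2 e1 e3 * det2 e4 e5\<close>; the terms free of \<open>det2 e1 e4\<close>
    cancel.\<close>
  then have "det2 e1 e4 * (det2 e1 e5 * det2 e2 e6 * det2 e3 e4) =
      det2 e1 e4 * (det2 e1 e6 * det2 e2 e4 * det2 e3 e5)"
    using det2_pluecker[of e1 e2 e4 e6] det2_pluecker[of e1 e3 e4 e5] by algebra
  then show ?thesis using nz by simp
qed

section \<open>Indices modulo 6 and the equivalences\<close>

text \<open>Six distinct residues exhaust a type with six elements.\<close>

lemma forall_6: "(\<forall>j::6. P j) \<longleftrightarrow> P 1 \<and> P 2 \<and> P 3 \<and> P 4 \<and> P 5 \<and> P 6"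
proof -
  have "card {1, 2, 3, 4, 5, 6 :: 6} = CARD(6)" by simp
  then have "{1, 2, 3, 4, 5, 6 :: 6} = UNIV" by (intro card_subset_eq) auto
  then show ?thesis by (metis UNIV_I insertE emptyE)
qed

lemma mod_6: "(7 :: 6) = 1" "(8 :: 6) = 2" "(9 :: 6) = 3"
  by simp_all

(* The six indices are p 1, ..., p 6, with p defined on the six-element type 6 of integers
   modulo 6 (where 6 = 0), so that j + 3 is computed modulo 6. *)
theorem theorem2:
  fixes H :: "'i \<Rightarrow> ('a::field ^ 2) set"
    and \<alpha> :: "'i \<Rightarrow> 'a ^ 2"
    and p :: "6 \<Rightarrow> 'i"
    and T :: "'i set set"
  assumes p: "inj p"
    and arrangement: "generic_arrangement (range p) H"
    and normals: "\<And>j. normal_vector (\<alpha> (p j)) (H (p j))"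
    and T: "T = {{p 1, p 2, p 3}, {p 1, p 5, p 6}, {p 2, p 4, p 6}, {p 3, p 4, p 5}}"
  defines "stmt_i \<equiv> admits_KT_translated (range p) H T"
    and "stmt_ii \<equiv>
      (det2 (\<alpha> (p 1)) (\<alpha> (p 5)) * det2 (\<alpha> (p 2)) (\<alpha> (p 6)) * det2 (\<alpha> (p 3)) (\<alpha> (p 4))) /
      (det2 (\<alpha> (p 1)) (\<alpha> (p 6)) * det2 (\<alpha> (p 2)) (\<alpha> (p 4)) * det2 (\<alpha> (p 3)) (\<alpha> (p 5))) = 1"
    and "stmt_iii \<equiv>
      (\<exists>f. projective_involution f \<and> (\<forall>j :: 6. f (H (p j)) = H (p (j + 3))))"
  shows "(stmt_i \<longleftrightarrow> stmt_ii) \<and> (stmt_ii \<longleftrightarrow> stmt_iii)"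
proof -
  define D where "D i j = det2 (\<alpha> (p i)) (\<alpha> (p j))" for i j
  define e where "e j = direction (\<alpha> (p j))" for j
  have D_neq_0: "D i j \<noteq> 0" if "i \<noteq> j" for i j
  proof -
    have "H (p i) \<noteq> H (p j)"
      using that p arrangement by (auto simp: generic_arrangement_def inj_on_def)
    then show ?thesis unfolding D_def by (rule det2_normals_neq_0[OF normals normals])
  qed
  have det_e: "det2 (e i) (e j) = D i j" for i j by (simp add: e_def D_def)
  have \<alpha>_neq_0: "\<alpha> (p j) \<noteq> 0" for j using normals by (auto simp: normal_vector_def)
  then have e_neq_0: "e j \<noteq> 0" for j by (simp add: e_def)
  have H: "H (p j) = range (\<lambda>c. c *s e j)" for j
    using normal_vector_imp_range[OF normals] by (simp add: e_def)
  have p_eq [simp]: "p i = p j \<longleftrightarrow> i = j" for i j using p by (simp add: inj_eq)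
  \<comment> \<open>The denominator is a product of determinants of distinct lines, so it can be
    cleared.\<close>
  have ii: "stmt_ii \<longleftrightarrow> D 1 5 * D 2 6 * D 3 4 = D 1 6 * D 2 4 * D 3 5"
    using D_neq_0 by (simp add: stmt_ii_def flip: D_def)

  have "stmt_ii" if i: "stmt_i"
  proof -
    from i obtain M where par: "\<And>j. parallel (H (p j)) (M (p j))"
      and M: "\<forall>L\<in>T. \<exists>P. (\<Inter>i\<in>L. M i) = {P} \<and> {i \<in> range p. P \<in> M i} = L"
      by (auto simp: stmt_i_def admits_KT_translated_def is_KT_translated_def is_translate_def)
    have diff: "scalar_product (\<alpha> (p j)) (v - w) = 0" if "v \<in> M (p j)" "w \<in> M (p j)" for j v w
      using that par[of j] parallel_iff_level_set[OF normals] by (auto simp: scalar_product_diff)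
    have ex: "\<exists>P. \<forall>j. P \<in> M (p j) \<longleftrightarrow> p j \<in> L" if "L \<in> T" for L
    proof -
      obtain P where P: "{i \<in> range p. P \<in> M i} = L"
        using bspec[OF M \<open>L \<in> T\<close>] by (elim exE conjE)
      have "\<forall>j. P \<in> M (p j) \<longleftrightarrow> p j \<in> L" unfolding P[symmetric] by simp
      then show ?thesis by (rule exI)
    qed
    obtain P1 where P1: "\<And>j. P1 \<in> M (p j) \<longleftrightarrow> p j \<in> {p 1, p 2, p 3}"
      using ex[of "{p 1, p 2, p 3}"] unfolding T by (meson insertI1 insertI2)
    obtain P2 where P2: "\<And>j. P2 \<in> M (p j) \<longleftrightarrow> p j \<in> {p 1, p 5, p 6}"
      using ex[of "{p 1, p 5, p 6}"] unfolding T by (meson insertI1 insertI2)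
    obtain P3 where P3: "\<And>j. P3 \<in> M (p j) \<longleftrightarrow> p j \<in> {p 2, p 4, p 6}"
      using ex[of "{p 2, p 4, p 6}"] unfolding T by (meson insertI1 insertI2)
    obtain P4 where P4: "\<And>j. P4 \<in> M (p j) \<longleftrightarrow> p j \<in> {p 3, p 4, p 5}"
      using ex[of "{p 3, p 4, p 5}"] unfolding T by (meson insertI1 insertI2)
    have "P2 - P1 \<noteq> 0" using P1[of 5] P2[of 5] by auto
    moreover have "scalar_product (\<alpha> (p 1)) (P2 - P1) = 0" "scalar_product (\<alpha> (p 2)) (P3 - P1) = 0"
      "scalar_product (\<alpha> (p 3)) (P4 - P1) = 0"
      "scalar_product (\<alpha> (p 6)) (P2 - P3) = 0" "scalar_product (\<alpha> (p 4)) (P3 - P4) = 0"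
      "scalar_product (\<alpha> (p 5)) (P2 - P4) = 0"
      by (rule diff; simp add: P1 P2 P3 P4)+
    ultimately show ?thesis
      unfolding ii D_def
      by (intro det2_condition_of_vertices[where u = "P2 - P1" and v = "P3 - P1" and w = "P4 - P1"])
        (auto simp: \<alpha>_neq_0 scalar_product_diff)
  qed

  moreover have "stmt_i" if "stmt_ii"
  proof -
    define P2 P3 P4 where "P2 = (D 6 2 * D 5 3) *s e 1" and "P3 = (D 6 1 * D 5 3) *s e 2"
      and "P4 = (D 5 1 * D 6 2) *s e 3"
    define Q where "Q i = (if i \<in> {p 1, p 2, p 3} then 0 else if i = p 4 then P3 else P2)" for i
    define M where "M i = {v. scalar_product (\<alpha> i) v = scalar_product (\<alpha> i) (Q i)}" for i
    have sp: "scalar_product (\<alpha> (p j)) P2 = D 6 2 * D 5 3 * D j 1"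
      "scalar_product (\<alpha> (p j)) P3 = D 6 1 * D 5 3 * D j 2"
      "scalar_product (\<alpha> (p j)) P4 = D 5 1 * D 6 2 * D j 3"
      "scalar_product (\<alpha> (p j)) 0 = 0" for j
      by (simp_all add: P2_def P3_def P4_def e_def D_def scalar_product_scale
          scalar_product_direction scalar_product_0)
    have D_swap: "D j i = - D i j" for i j by (simp add: D_def det2_swap[of "\<alpha> (p j)"])
    have D_same: "D j j = 0" for j by (simp add: D_def det2_eq)
    have pl: "D i j * D k l - D i k * D j l + D i l * D j k = 0" for i j k l
      unfolding D_def by (rule det2_pluecker)
    have rel: "D 5 1 * D 6 2 * D 4 3 = D 6 1 * D 5 3 * D 4 2"
      using that unfolding ii D_swap[of 5 1] D_swap[of 6 2] D_swap[of 4 3] D_swap[of 6 1]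
        D_swap[of 5 3] D_swap[of 4 2] by algebra
    have n4: "D 6 2 * D 5 3 * D 4 1 \<noteq> D 6 1 * D 5 3 * D 4 2"
    proof
      assume "D 6 2 * D 5 3 * D 4 1 = D 6 1 * D 5 3 * D 4 2"
      then have "D 5 3 * (D 4 6 * D 1 2) = 0"
        using pl[of 4 6 1 2] by algebra
      then show False using D_neq_0 by simp
    qed
    have n5: "D 6 1 * D 5 3 * D 5 2 \<noteq> D 6 2 * D 5 3 * D 5 1"
    proof
      assume "D 6 1 * D 5 3 * D 5 2 = D 6 2 * D 5 3 * D 5 1"
      then have "D 5 3 * (D 5 6 * D 1 2) = 0"
        using pl[of 5 6 1 2] by algebra
      then show False using D_neq_0 by simp
    qed
    have n6: "D 5 1 * D 6 2 * D 6 3 \<noteq> D 6 2 * D 5 3 * D 6 1"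
    proof
      assume "D 5 1 * D 6 2 * D 6 3 = D 6 2 * D 5 3 * D 6 1"
      then have "D 6 2 * (D 5 6 * D 1 3) = 0"
        using pl[of 5 6 1 3] by algebra
      then show False using D_neq_0 by simp
    qed
    have memb: "\<forall>j. 0 \<in> M (p j) \<longleftrightarrow> j \<in> {1, 2, 3}" "\<forall>j. P2 \<in> M (p j) \<longleftrightarrow> j \<in> {1, 5, 6}"
      "\<forall>j. P3 \<in> M (p j) \<longleftrightarrow> j \<in> {2, 4, 6}" "\<forall>j. P4 \<in> M (p j) \<longleftrightarrow> j \<in> {3, 4, 5}"
      unfolding forall_6 M_def Q_def using n4 n5 n6 rel D_neq_0
      by (auto simp: sp D_same)
    \<comment> \<open>The exact incidences of \<open>P\<close> give the second conjunct; for the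
      first, lines \<open>i\<close> and \<open>j\<close> already meet only in
      \<open>P\<close>.\<close>
    have point: "\<exists>P. (\<Inter>i\<in>{p i, p j, p k}. M i) = {P} \<and> {i \<in> range p. P \<in> M i} = {p i, p j, p k}"
      if P: "\<forall>l. P \<in> M (p l) \<longleftrightarrow> l \<in> {i, j, k}" and "i \<noteq> j" for P i j k
    proof (intro exI conjI)
      have mem: "P \<in> M (p i)" "P \<in> M (p j)" "P \<in> M (p k)" using P by simp_all
      have "v = P" if "v \<in> M (p i)" "v \<in> M (p j)" for v
        using that mem D_neq_0[OF \<open>i \<noteq> j\<close>] unfolding M_def D_def
        by (intro scalar_product_eq_imp_eq[of "\<alpha> (p i)" "\<alpha> (p j)"]) simp_all
      then show "(\<Inter>i\<in>{p i, p j, p k}. M i) = {P}" using mem by blast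
      show "{i \<in> range p. P \<in> M i} = {p i, p j, p k}" using P by auto
    qed
    have "is_translate (range p) H M"
      using parallel_iff_level_set[OF normals] by (auto simp: is_translate_def M_def)
    moreover have "\<forall>L\<in>T. \<exists>P. (\<Inter>i\<in>L. M i) = {P} \<and> {i \<in> range p. P \<in> M i} = L"
      unfolding T ball_simps
      by (intro conjI TrueI point[OF memb(1)] point[OF memb(2)] point[OF memb(3)]
          point[OF memb(4)]) simp_all
    ultimately show ?thesis
      unfolding stmt_i_def admits_KT_translated_def is_KT_translated_def by blast
  qed

  moreover have "stmt_iii" if "stmt_ii"
  proof -
    have nz: "det2 (e i) (e j) \<noteq> 0" if "i \<noteq> j" for i j
      using that D_neq_0 by (simp add: det_e)
    have eq: "det2 (e 1) (e 5) * det2 (e 2) (e 6) * det2 (e 3) (e 4) =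
        det2 (e 1) (e 6) * det2 (e 2) (e 4) * det2 (e 3) (e 5)"
      using that by (simp add: ii det_e)
    obtain A :: "'a ^ 2 ^ 2" and k where "k \<noteq> 0" and A2: "\<And>v. A *v (A *v v) = k *s v"
      and zero: "det2 (A *v e 1) (e 4) = 0" "det2 (A *v e 2) (e 5) = 0" "det2 (A *v e 3) (e 6) = 0"
      by (rule involutory_matrix_exists[OF _ _ _ _ _ eq]) ((rule nz, simp)+, blast)
    \<comment> \<open>Since \<open>A\<close> squared is the nonzero scalar \<open>k\<close>,
      applying \<open>A\<close> to \<open>A *v e i = c *s e j\<close> forces \<open>c\<close> to be
      nonzero and sends \<open>e j\<close> back to the line of \<open>e i\<close>. Three determinant
      conditions thus settle all six indices.\<close>
    have swap: "(*v) A ` H (p i) = H (p j) \<and> (*v) A ` H (p j) = H (p i)"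
      if zero: "det2 (A *v e i) (e j) = 0" for i j
    proof -
      obtain c where c: "A *v e i = c *s e j"
        using zero e_neq_0 by (rule det2_eq_0_imp_multiple)
      have "k *s e i = c *s (A *v e j)"
        using A2[of "e i"] by (simp add: c vector_scalar_commute)
      moreover have "c \<noteq> 0"
        using calculation \<open>k \<noteq> 0\<close> e_neq_0[of i] by auto
      ultimately have "A *v e j = (k / c) *s e i"
        by (auto simp: vec_eq_2 field_simps)
      then show ?thesis
        using c \<open>c \<noteq> 0\<close> \<open>k \<noteq> 0\<close> by (simp add: H image_range_scale)
    qed
    have "inj ((*v) A)"
    proof (rule injI)
      fix v w assume "A *v v = A *v w"
      then have "k *s v = k *s w" by (metis A2)
      then show "v = w" using \<open>k \<noteq> 0\<close> by simp
    qed
    then have "invertible A"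
      by (simp add: invertible_left_inverse matrix_left_invertible_injective)
    moreover have "(*v) A ` (*v) A ` L = L" if "L \<in> line_at_infinity" for L
    proof -
      \<comment> \<open>A line through the origin is invariant under scaling by \<open>k\<close>, so
        the square of \<open>A\<close> acts trivially on it.\<close>
      have L: "c *s v \<in> L" if "v \<in> L" for c v
        using \<open>L \<in> line_at_infinity\<close> that by (auto simp: line_at_infinity_def vec.subspace_scale)
      moreover have "v = k *s ((1 / k) *s v)" for v :: "'a ^ 2" using \<open>k \<noteq> 0\<close> by simp
      ultimately have "(*s) k ` L = L" by blast
      then show ?thesis by (simp add: image_image A2)
    qed
    ultimately have "projective_involution ((`) ((*v) A))"
      unfolding projective_involution_def projective_transformation_def by blast
    moreover have "\<forall>j::6. (*v) A ` H (p j) = H (p (j + 3))"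
      unfolding forall_6 using zero[THEN swap] by (simp add: mod_6)
    ultimately show ?thesis unfolding stmt_iii_def by blast
  qed

  moreover have "stmt_ii" if iii: "stmt_iii"
  proof -
    from iii obtain f where f: "projective_involution f" "\<And>j::6. f (H (p j)) = H (p (j + 3))"
      unfolding stmt_iii_def by blast
    from f(1) obtain A :: "'a ^ 2 ^ 2" where "invertible A" and "\<forall>L\<in>line_at_infinity. f L = (*v) A ` L"
      unfolding projective_involution_def projective_transformation_def by blast
    then have image: "(*v) A ` H (p j) = H (p (j + 3))" for j
      using f(2)[of j] arrangement by (auto simp: generic_arrangement_def)
    have mult: "\<exists>c. A *v e j = c *s e (j + 3)" for j
    proof -
      have "e j \<in> H (p j)" unfolding H by (rule range_eqI[of _ _ 1]) simp
      then have "A *v e j \<in> H (p (j + 3))" using image[of j] by blast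
      then show ?thesis by (auto simp: H)
    qed
    \<comment> \<open>The cases \<open>j = 1\<close> and \<open>j = 4\<close> together say that
      \<open>A\<close> exchanges the two lines, because \<open>4 + 3 = 1\<close> modulo 6.\<close>
    obtain t where t: "A *v e 1 = t *s e 4" using mult[of 1] by auto
    obtain s where s: "A *v e 4 = s *s e 1" using mult[of 4] by (auto simp: mod_6)
    have "t \<noteq> 0"
    proof
      assume "t = 0"
      then have "A *v e 1 = 0" by (simp add: t)
      moreover obtain B where "B ** A = mat 1"
        using \<open>invertible A\<close> by (auto simp: invertible_def)
      then have "B *v (A *v e 1) = e 1" by (simp add: matrix_vector_mul_assoc)
      ultimately show False using e_neq_0 by simp
    qed
    have "det2 (A *v e 2) (e 5) = 0" "det2 (A *v e 3) (e 6) = 0"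
      using mult[of 2] mult[of 3] by (auto simp: det2_eq)
    then show ?thesis
      using det2_condition_of_matrix[OF _ t s \<open>t \<noteq> 0\<close>, of "e 2" "e 5" "e 3" "e 6"] D_neq_0
      by (simp add: ii det_e)
  qed

  ultimately show ?thesis by blast
qed

end
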